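(* The map $T$ has a unique fixed point $\bar\varphi\in\mathcal F$, and for every $\varphi\in\mathcal F$ and every integer $k\ge 0$, \[ \|\bar\varphi-T^k\varphi\|_{\infty,1}\le q^k\|\bar\varphi-\varphi\|_{\infty,1},\qquad \|\bar\varphi-\varphi\|_{\infty,1}\le \frac{1}{p}\|T\varphi-\varphi\|_{\infty,1}. \]
   Context: Let $G=(V,E)$ be an undirected, simple, connected graph with $V=\{1,\dots,n\}$, $n\ge 2$. For $i\in V$ let $N(i)=\{j\in V:\{i,j\}\in E\}$. Let $L$ be a finite set of labels. For each $i\in V$ let $g_i:L\to[0,\infty)$, and for each $\{i,j\}\in E$ let $h_{ij},h_{ji}:L^2\to[0,\infty)$ with $h_{ij}(a,b)=h_{ji}(b,a)$. Fix $p\in(0,1)$, $q=1-p$, and weights $w_{ij}\in[0,1]$ for $i\in V$, $j\in N(i)$, with $\sum_{j\in N(i)}w_{ij}=1$ for every $i\in V$. Let $\mathcal{F}$ be the set of tuples $\varphi=(\varphi_1,\dots,\varphi_n)$ with $\varphi_i:L\to\mathbb{R}$. For $\gamma:L\to\mathbb{R}$, $\|\gamma\|_\infty=\max_{\tau\in L}|\gamma(\tau)|$, and for $\varphi\in\mathcal F$, $\|\varphi\|_{\infty,1}=\sum_{i\in V}\|\varphi_i\|_\infty$. The map $T:\mathcal F\to\mathcal F$ is defined by \[ (T\varphi)_i(\tau)=p\,g_i(\tau)+\sum_{j\in N(i)}\min_{u_j\in L}\Big(\tfrac{p}{2}h_{ij}(\tau,u_j)+q\,w_{ji}\,\varphi_j(u_j)\Big).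 \] *)

theory Defs
  imports "HOL-Analysis.Analysis"
begin

definition simple_graph :: "'v set \<Rightarrow> 'v set set \<Rightarrow> bool" where
  "simple_graph V E \<longleftrightarrow> (\<forall>e\<in>E. e \<subseteq> V \<and> card e = 2)"

definition graph_connected :: "'v set \<Rightarrow> 'v set set \<Rightarrow> bool" where
  "graph_connected V E \<longleftrightarrow> (\<forall>u\<in>V. \<forall>v\<in>V. (u, v) \<in> {(i, j). {i, j} \<in> E}\<^sup>*)"

definition nbhd :: "'v set \<Rightarrow> 'v set set \<Rightarrow> 'v \<Rightarrow> 'v set" where
  "nbhd V E i = {j \<in> V. {i, j} \<in> E}"

text \<open>Tuples of functions \<open>L \<rightarrow> \<real>\<close> indexed by \<open>V\<close>, represented as extensional functions, so
  that HOL equality on this set is equality of tuples.\<close>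
definition tuples :: "'v set \<Rightarrow> 'l set \<Rightarrow> ('v \<Rightarrow> 'l \<Rightarrow> real) set" where
  "tuples V L = V \<rightarrow>\<^sub>E (L \<rightarrow>\<^sub>E UNIV)"

definition sup_norm :: "'l set \<Rightarrow> ('l \<Rightarrow> real) \<Rightarrow> real" where
  "sup_norm L \<gamma> = (MAX \<tau>\<in>L. \<bar>\<gamma> \<tau>\<bar>)"

definition norm_inf_1 :: "'v set \<Rightarrow> 'l set \<Rightarrow> ('v \<Rightarrow> 'l \<Rightarrow> real) \<Rightarrow> real" where
  "norm_inf_1 V L \<phi> = (\<Sum>i\<in>V. sup_norm L (\<phi> i))"

definition T_map ::
  "'v set \<Rightarrow> 'v set set \<Rightarrow> 'l set \<Rightarrow> ('v \<Rightarrow> 'l \<Rightarrow> real) \<Rightarrow> ('v \<Rightarrow> 'v \<Rightarrow> 'l \<Rightarrow> 'l \<Rightarrow> real) \<Rightarrow>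
   real \<Rightarrow> ('v \<Rightarrow> 'v \<Rightarrow> real) \<Rightarrow> ('v \<Rightarrow> 'l \<Rightarrow> real) \<Rightarrow> ('v \<Rightarrow> 'l \<Rightarrow> real)" where
  "T_map V E L g h p w \<phi> = (\<lambda>i\<in>V. \<lambda>\<tau>\<in>L.
     p * g i \<tau> +
     (\<Sum>j\<in>nbhd V E i. MIN u\<in>L. p / 2 * h i j \<tau> u + (1 - p) * w j i * \<phi> j u))"

lemma T_map_in_tuples: "T_map V E L g h p w \<phi> \<in> tuples V L"
  by (auto simp: T_map_def tuples_def)

end

theory Submission
  imports Defs
begin

text \<open>\<open>T\<close> contracts \<open>norm_inf_1\<close> by the factor \<open>q\<close>: a minimum over \<open>L\<close> is 1-Lipschitz for the
  sup norm, so the \<open>i\<close>-th component of \<open>T \<phi> - T \<psi>\<close> has sup norm at most the sum of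
  \<open>q * w j i * sup_norm L (\<phi> j - \<psi> j)\<close> over the neighbours \<open>j\<close> of \<open>i\<close>. Summing over \<open>i\<close> and
  exchanging the sums, each \<open>j\<close> contributes with total weight \<open>q\<close>, because the weights
  \<open>w j i\<close> add up to 1 over the neighbours \<open>i\<close> of \<open>j\<close>. The rest is Banach's fixed point theorem.\<close>

section \<open>The norm on tuples and its coordinates\<close>

lemma abs_le_sup_norm:
  assumes "finite L" "\<tau> \<in> L"
  shows "\<bar>\<gamma> \<tau>\<bar> \<le> sup_norm L \<gamma>"
  unfolding sup_norm_def using assms by (intro Max_ge) auto

lemma sup_norm_le:
  assumes "finite L" "L \<noteq> {}" "\<And>\<tau>. \<tau> \<in> L \<Longrightarrow> \<bar>\<gamma> \<tau>\<bar> \<le> c"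
  shows "sup_norm L \<gamma> \<le> c"
  unfolding sup_norm_def using assms by (subst Max_le_iff) auto

lemma sup_norm_nonneg:
  assumes "finite L" "L \<noteq> {}"
  shows "0 \<le> sup_norm L \<gamma>"
proof -
  obtain \<tau> where "\<tau> \<in> L" using assms(2) by blast
  then show ?thesis using abs_le_sup_norm[OF assms(1), of \<tau> \<gamma>] by linarith
qed

lemma abs_le_norm_inf_1:
  assumes "finite V" "finite L" "i \<in> V" "\<tau> \<in> L"
  shows "\<bar>\<phi> i \<tau>\<bar> \<le> norm_inf_1 V L \<phi>"
proof -
  have "\<bar>\<phi> i \<tau>\<bar> \<le> sup_norm L (\<phi> i)" by (rule abs_le_sup_norm[OF assms(2,4)])
  also have "\<dots> \<le> norm_inf_1 V L \<phi>"
    unfolding norm_inf_1_def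
  proof (rule member_le_sum[OF assms(3) _ assms(1)])
    show "0 \<le> sup_norm L (\<phi> j)" for j
      using assms(2,4) by (intro sup_norm_nonneg) auto
  qed
  finally show ?thesis .
qed

text \<open>Together with \<open>abs_le_norm_inf_1\<close> this compares the norm with finitely many
  coordinates, so that coordinatewise convergence on \<open>V\<close> and \<open>L\<close> yields
  convergence in norm.\<close>

lemma norm_inf_1_le_sum_abs:
  assumes "finite L" "L \<noteq> {}"
  shows "norm_inf_1 V L \<phi> \<le> (\<Sum>i\<in>V. \<Sum>\<tau>\<in>L. \<bar>\<phi> i \<tau>\<bar>)"
  unfolding norm_inf_1_def
proof (intro sum_mono sup_norm_le assms)
  fix i \<tau> assume "\<tau> \<in> L"
  then show "\<bar>\<phi> i \<tau>\<bar> \<le> (\<Sum>\<tau>\<in>L. \<bar>\<phi> i \<tau>\<bar>)"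
    using assms(1) by (intro member_le_sum[of \<tau> L "\<lambda>\<tau>. \<bar>\<phi> i \<tau>\<bar>"]) auto
qed

lemma norm_inf_1_triangle:
  assumes "finite L" "L \<noteq> {}"
  shows "norm_inf_1 V L (\<phi> - \<theta>) \<le> norm_inf_1 V L (\<phi> - \<psi>) + norm_inf_1 V L (\<psi> - \<theta>)"
  unfolding norm_inf_1_def sum.distrib[symmetric]
proof (intro sum_mono sup_norm_le assms)
  fix i \<tau> assume "\<tau> \<in> L"
  then have "\<bar>(\<phi> - \<psi>) i \<tau>\<bar> \<le> sup_norm L ((\<phi> - \<psi>) i)"
    and "\<bar>(\<psi> - \<theta>) i \<tau>\<bar> \<le> sup_norm L ((\<psi> - \<theta>) i)"
    by (rule abs_le_sup_norm[OF assms(1)])+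
  then show "\<bar>(\<phi> - \<theta>) i \<tau>\<bar> \<le> sup_norm L ((\<phi> - \<psi>) i) + sup_norm L ((\<psi> - \<theta>) i)"
    by simp
qed

text \<open>The norm sees only arguments in \<open>V\<close> and \<open>L\<close>, so norm zero
  gives equality there. At all other arguments extensionality fixes the values.\<close>

lemma tuples_eqI:
  assumes "finite V" "finite L" "\<phi> \<in> tuples V L" "\<psi> \<in> tuples V L"
    and "norm_inf_1 V L (\<phi> - \<psi>) \<le> 0"
  shows "\<phi> = \<psi>"
proof -
  have eq: "\<phi> i \<tau> = \<psi> i \<tau>" if "i \<in> V" "\<tau> \<in> L" for i \<tau>
    using abs_le_norm_inf_1[OF assms(1,2) that, of "\<phi> - \<psi>"] assms(5) by simp
  have "\<phi> i = \<psi> i" if "i \<in> V" for i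
  proof (rule PiE_ext)
    show "\<phi> i \<in> L \<rightarrow>\<^sub>E UNIV" "\<psi> i \<in> L \<rightarrow>\<^sub>E UNIV"
      using assms(3,4) that by (auto simp: tuples_def)
  qed (use eq that in auto)
  then show ?thesis
    using assms(3,4) unfolding tuples_def by (intro PiE_ext) auto
qed

section \<open>The contraction estimate\<close>

lemma abs_Min_diff_le:
  fixes f f' :: "'l \<Rightarrow> real"
  assumes "finite L" "L \<noteq> {}" "\<And>u. u \<in> L \<Longrightarrow> \<bar>f u - f' u\<bar> \<le> c"
  shows "\<bar>(MIN u\<in>L. f u) - (MIN u\<in>L. f' u)\<bar> \<le> c"
proof -
  have *: "(MIN u\<in>L. a u) \<le> (MIN u\<in>L. b u) + c"
    if "\<And>u. u \<in> L \<Longrightarrow> \<bar>a u - b u\<bar> \<le> c" for a b :: "'l \<Rightarrow> real"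
  proof -
    \<comment> \<open>A minimiser \<open>v\<close> of \<open>b\<close> is a competitor in the
      minimum of \<open>a\<close>. This gives the one-sided bound, which is then used in both
      directions.\<close>
    have "Min (b ` L) \<in> b ` L" using assms by (intro Min_in) auto
    then obtain v where v: "v \<in> L" "(MIN u\<in>L. b u) = b v" by auto
    have "(MIN u\<in>L. a u) \<le> a v" using assms v by (intro Min_le) auto
    then show ?thesis using that[OF v(1)] v(2) by linarith
  qed
  have "\<bar>f' u - f u\<bar> \<le> c" if "u \<in> L" for u
    using assms(3)[OF that] by linarith
  then have "(MIN u\<in>L. f' u) \<le> (MIN u\<in>L. f u) + c" by (rule *)
  moreover have "(MIN u\<in>L. f u) \<le> (MIN u\<in>L. f' u) + c" by (rule *[OF assms(3)])
  ultimately show ?thesis by linarith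
qed

lemma norm_inf_1_T_map_diff_le:
  assumes V: "finite V" and L: "finite L" "L \<noteq> {}" and p: "p \<le> 1"
    and w: "\<And>i j. i \<in> V \<Longrightarrow> j \<in> nbhd V E i \<Longrightarrow> 0 \<le> w i j"
    and w1: "\<And>i. i \<in> V \<Longrightarrow> (\<Sum>j\<in>nbhd V E i. w i j) = 1"
  shows "norm_inf_1 V L (T_map V E L g h p w \<phi> - T_map V E L g h p w \<psi>)
    \<le> (1 - p) * norm_inf_1 V L (\<phi> - \<psi>)"
proof -
  let ?T = "T_map V E L g h p w"
  let ?s = "\<lambda>j. sup_norm L ((\<phi> - \<psi>) j)"
  have nb_sym: "i \<in> V \<Longrightarrow> j \<in> nbhd V E i \<Longrightarrow> j \<in> V \<and> i \<in> nbhd V E j" for i j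
    by (auto simp: nbhd_def insert_commute)
  have "sup_norm L ((?T \<phi> - ?T \<psi>) i) \<le> (\<Sum>j\<in>nbhd V E i. (1 - p) * w j i * ?s j)"
    if i: "i \<in> V" for i
  proof (intro sup_norm_le L)
    fix \<tau> assume \<tau>: "\<tau> \<in> L"
    let ?f = "\<lambda>\<phi> j u. p / 2 * h i j \<tau> u + (1 - p) * w j i * \<phi> j u"
    have "\<bar>(?T \<phi> - ?T \<psi>) i \<tau>\<bar>
        = \<bar>\<Sum>j\<in>nbhd V E i. (MIN u\<in>L. ?f \<phi> j u) - (MIN u\<in>L. ?f \<psi> j u)\<bar>"
      using i \<tau> by (simp add: T_map_def sum_subtractf)
    also have "\<dots> \<le> (\<Sum>j\<in>nbhd V E i. \<bar>(MIN u\<in>L. ?f \<phi> j u) - (MIN u\<in>L. ?f \<psi> j u)\<bar>)"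
      by (rule sum_abs)
    also have "\<dots> \<le> (\<Sum>j\<in>nbhd V E i. (1 - p) * w j i * ?s j)"
    proof (rule sum_mono, rule abs_Min_diff_le[OF L])
      fix j u assume j: "j \<in> nbhd V E i" and u: "u \<in> L"
      \<comment> \<open>The weight is \<open>w j i\<close>, with \<open>j\<close> as first index, so
        its sign comes from the hypothesis at \<open>j\<close>; \<open>nb_sym\<close> supplies
        \<open>i\<close> as a neighbour of \<open>j\<close>.\<close>
      have c: "0 \<le> (1 - p) * w j i" using w nb_sym[OF i j] p by simp
      have "?f \<phi> j u - ?f \<psi> j u = (1 - p) * w j i * (\<phi> - \<psi>) j u"
        by (simp add: right_diff_distrib)
      then have "\<bar>?f \<phi> j u - ?f \<psi> j u\<bar> = (1 - p) * w j i * \<bar>(\<phi> - \<psi>) j u\<bar>"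
        using abs_mult[of "(1 - p) * w j i" "(\<phi> - \<psi>) j u"] abs_of_nonneg[OF c] by metis
      also have "\<dots> \<le> (1 - p) * w j i * ?s j"
        by (rule mult_left_mono[OF abs_le_sup_norm[OF L(1) u] c])
      finally show "\<bar>?f \<phi> j u - ?f \<psi> j u\<bar> \<le> (1 - p) * w j i * ?s j" .
    qed
    finally show "\<bar>(?T \<phi> - ?T \<psi>) i \<tau>\<bar> \<le> (\<Sum>j\<in>nbhd V E i. (1 - p) * w j i * ?s j)" .
  qed
  then have "norm_inf_1 V L (?T \<phi> - ?T \<psi>)
      \<le> (\<Sum>i\<in>V. \<Sum>j\<in>nbhd V E i. (1 - p) * w j i * ?s j)"
    unfolding norm_inf_1_def by (intro sum_mono)
  also have "\<dots> = (\<Sum>i\<in>V. \<Sum>j\<in>{j\<in>V. {i, j} \<in> E}. (1 - p) * w j i * ?s j)"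
    by (simp add: nbhd_def)
  also have "\<dots> = (\<Sum>j\<in>V. \<Sum>i\<in>{i\<in>V. {i, j} \<in> E}. (1 - p) * w j i * ?s j)"
    by (rule sum.swap_restrict[OF V V])
  \<comment> \<open>Since \<open>{i, j}\<close> is unordered, the inner range after the exchange is
    \<open>nbhd V E j\<close>. Over it the weights \<open>w j i\<close> sum to 1 by
    \<open>w1\<close>.\<close>
  also have "\<dots> = (\<Sum>j\<in>V. (1 - p) * (\<Sum>i\<in>nbhd V E j. w j i) * ?s j)"
    by (simp add: nbhd_def insert_commute sum_distrib_left sum_distrib_right)
  also have "\<dots> = (1 - p) * norm_inf_1 V L (\<phi> - \<psi>)"
    by (simp add: w1 norm_inf_1_def sum_distrib_left)
  finally show ?thesis .
qed

section \<open>Banach's fixed point theorem for \<open>norm_inf_1\<close>\<close>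

lemma contraction_funpow_le:
  assumes T: "\<And>\<phi> \<psi>. norm_inf_1 V L (T \<phi> - T \<psi>) \<le> q * norm_inf_1 V L (\<phi> - \<psi>)"
    and q: "0 \<le> q"
  shows "norm_inf_1 V L ((T ^^ k) \<phi> - (T ^^ k) \<psi>) \<le> q ^ k * norm_inf_1 V L (\<phi> - \<psi>)"
proof (induction k)
  case (Suc k)
  have "norm_inf_1 V L ((T ^^ Suc k) \<phi> - (T ^^ Suc k) \<psi>)
      \<le> q * norm_inf_1 V L ((T ^^ k) \<phi> - (T ^^ k) \<psi>)"
    using T by simp
  also have "\<dots> \<le> q * (q ^ k * norm_inf_1 V L (\<phi> - \<psi>))"
    using Suc.IH q by (rule mult_left_mono)
  finally show ?case by (simp only: power_Suc mult.assoc)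
qed simp

text \<open>Picard iteration. Completeness is that of the reals, applied to each coordinate; the
  contraction bound then carries \<open>T\<close> through the limit.\<close>

lemma contraction_fixed_point_exists:
  assumes V: "finite V" and L: "finite L" "L \<noteq> {}"
    and T_in: "\<And>\<phi>. T \<phi> \<in> tuples V L"
    and T: "\<And>\<phi> \<psi>. norm_inf_1 V L (T \<phi> - T \<psi>) \<le> q * norm_inf_1 V L (\<phi> - \<psi>)"
    and q: "0 \<le> q" "q < 1"
  shows "\<exists>\<phi>\<in>tuples V L. T \<phi> = \<phi>"
proof -
  \<comment> \<open>The zero function need not lie in \<open>tuples V L\<close>. This is harmless,
    because the contraction bound covers all functions and only the limit has to be a tuple.\<close>
  define x where "x k = (T ^^ k) (\<lambda>_ _. 0)" for k
  let ?C = "norm_inf_1 V L (x 1 - x 0)"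
  have step: "norm_inf_1 V L (x (Suc k) - x k) \<le> q ^ k * ?C" for k
    using contraction_funpow_le[of V L T q k "T (\<lambda>_ _. 0)" "\<lambda>_ _. 0"] T q
    by (simp add: x_def funpow_swap1)
  have conv: "convergent (\<lambda>k. x k i \<tau>)" if "i \<in> V" "\<tau> \<in> L" for i \<tau>
  proof -
    \<comment> \<open>The increments of a coordinate are dominated by a geometric series, and their
      partial sums telescope to \<open>x n i \<tau> - x 0 i \<tau>\<close>, where \<open>x 0\<close>
      vanishes.\<close>
    have "\<bar>x (Suc k) i \<tau> - x k i \<tau>\<bar> \<le> q ^ k * ?C" for k
      using abs_le_norm_inf_1[OF V L(1) that, of "x (Suc k) - x k"] step[of k] by simp
    moreover have "summable (\<lambda>k. q ^ k * ?C)"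
      using q by (intro summable_mult2 summable_geometric) auto
    ultimately have "summable (\<lambda>k. x (Suc k) i \<tau> - x k i \<tau>)"
      by (auto intro: summable_comparison_test'[of "\<lambda>k. q ^ k * ?C" 0])
    then have "convergent (\<lambda>n. \<Sum>k<n. x (Suc k) i \<tau> - x k i \<tau>)"
      by (simp add: summable_iff_convergent)
    then have "convergent (\<lambda>n. x n i \<tau> - x 0 i \<tau>)"
      by (simp add: sum_lessThan_telescope[of "\<lambda>k. x k i \<tau>"])
    then show ?thesis by (simp add: x_def)
  qed
  \<comment> \<open>Restricting the coordinatewise limit to \<open>V\<close> and \<open>L\<close>
    makes it extensional.\<close>
  define y where "y = (\<lambda>i\<in>V. \<lambda>\<tau>\<in>L. lim (\<lambda>k. x k i \<tau>))"
  have y_in: "y \<in> tuples V L" by (auto simp: y_def tuples_def)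
  have lim: "(\<lambda>k. x k i \<tau>) \<longlonglongrightarrow> y i \<tau>" if "i \<in> V" "\<tau> \<in> L" for i \<tau>
    using conv[OF that] that
    by (simp add: y_def convergent_LIMSEQ_iff)
  let ?d = "\<lambda>k. \<Sum>i\<in>V. \<Sum>\<tau>\<in>L. \<bar>x k i \<tau> - y i \<tau>\<bar>"
  have d: "norm_inf_1 V L (x k - y) \<le> ?d k" "norm_inf_1 V L (y - x k) \<le> ?d k" for k
    using norm_inf_1_le_sum_abs[OF L, of V "x k - y"] norm_inf_1_le_sum_abs[OF L, of V "y - x k"]
    by (simp_all add: abs_minus_commute)
  have "?d \<longlonglongrightarrow> (\<Sum>i\<in>V. \<Sum>\<tau>\<in>L. \<bar>y i \<tau> - y i \<tau>\<bar>)"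
    by (intro tendsto_sum tendsto_rabs tendsto_diff tendsto_const lim)
  then have d0: "?d \<longlonglongrightarrow> 0" by simp
  \<comment> \<open>The left side does not depend on \<open>k\<close>. Comparing \<open>T y\<close>
    and \<open>y\<close> with \<open>x (Suc k) = T (x k)\<close> bounds it by a null
    sequence.\<close>
  have "norm_inf_1 V L (T y - y) \<le> q * ?d k + ?d (Suc k)" for k
  proof -
    have "norm_inf_1 V L (T y - y)
        \<le> norm_inf_1 V L (T y - x (Suc k)) + norm_inf_1 V L (x (Suc k) - y)"
      by (rule norm_inf_1_triangle[OF L])
    also have "norm_inf_1 V L (T y - x (Suc k)) \<le> q * norm_inf_1 V L (y - x k)"
      using T[of y "x k"] by (simp add: x_def)
    also have "q * norm_inf_1 V L (y - x k) \<le> q * ?d k"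
      using d(2) q(1) by (rule mult_left_mono)
    finally show ?thesis using d(1)[of "Suc k"] by linarith
  qed
  moreover have "(\<lambda>k. q * ?d k + ?d (Suc k)) \<longlonglongrightarrow> q * 0 + 0"
    by (intro tendsto_add tendsto_mult tendsto_const d0 LIMSEQ_Suc[OF d0])
  ultimately have "norm_inf_1 V L (T y - y) \<le> q * 0 + 0"
    by (intro LIMSEQ_le_const) auto
  then have "T y = y"
    by (intro tuples_eqI[OF V L(1) T_in y_in]) simp
  then show ?thesis using y_in by blast
qed

text \<open>Insert \<open>T \<phi>\<close> between \<open>\<phi>'\<close> and \<open>\<phi>\<close>:
  the first piece is at most \<open>q\<close> times the whole distance and is absorbed on the left.
  For \<open>q = 1 - p\<close> the remaining factor is \<open>p\<close>, the source of
  \<open>1 / p\<close> in the theorem.\<close>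

lemma contraction_error_le:
  assumes L: "finite L" "L \<noteq> {}"
    and T: "\<And>\<phi> \<psi>. norm_inf_1 V L (T \<phi> - T \<psi>) \<le> q * norm_inf_1 V L (\<phi> - \<psi>)"
    and fp: "T \<phi>' = \<phi>'"
  shows "(1 - q) * norm_inf_1 V L (\<phi>' - \<phi>) \<le> norm_inf_1 V L (T \<phi> - \<phi>)"
proof -
  have "norm_inf_1 V L (\<phi>' - T \<phi>) \<le> q * norm_inf_1 V L (\<phi>' - \<phi>)"
    using T[of \<phi>' \<phi>] unfolding fp .
  then show ?thesis
    using norm_inf_1_triangle[OF L, of V \<phi>' \<phi> "T \<phi>"] unfolding left_diff_distrib by linarith
qed

theorem theorem1:
  fixes n :: nat and V :: "nat set" and E :: "nat set set" and L :: "'l set"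
    and g :: "nat \<Rightarrow> 'l \<Rightarrow> real"
    and h :: "nat \<Rightarrow> nat \<Rightarrow> 'l \<Rightarrow> 'l \<Rightarrow> real"
    and p q :: real and w :: "nat \<Rightarrow> nat \<Rightarrow> real"
    and T :: "(nat \<Rightarrow> 'l \<Rightarrow> real) \<Rightarrow> (nat \<Rightarrow> 'l \<Rightarrow> real)"
  defines "V \<equiv> {1..n}"
    and "q \<equiv> 1 - p"
    and "T \<equiv> T_map V E L g h p w"
  assumes "n \<ge> 2"
    and "simple_graph V E"
    and "graph_connected V E"
    and "finite L" and "L \<noteq> {}"
    and "\<And>i \<tau>. i \<in> V \<Longrightarrow> \<tau> \<in> L \<Longrightarrow> g i \<tau> \<ge> 0"
    and "\<And>i j a b. {i, j} \<in> E \<Longrightarrow> a \<in> L \<Longrightarrow> b \<in> L \<Longrightarrow> h i j a b \<ge> 0"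
    and "\<And>i j a b. {i, j} \<in> E \<Longrightarrow> a \<in> L \<Longrightarrow> b \<in> L \<Longrightarrow> h i j a b = h j i b a"
    and "0 < p" and "p < 1"
    and "\<And>i j. i \<in> V \<Longrightarrow> j \<in> nbhd V E i \<Longrightarrow> 0 \<le> w i j \<and> w i j \<le> 1"
    and "\<And>i. i \<in> V \<Longrightarrow> (\<Sum>j\<in>nbhd V E i. w i j) = 1"
  shows "(\<exists>!\<phi>'. \<phi>' \<in> tuples V L \<and> T \<phi>' = \<phi>') \<and>
    (\<forall>\<phi>'\<in>tuples V L. T \<phi>' = \<phi>' \<longrightarrow>
      (\<forall>\<phi>\<in>tuples V L. \<forall>k::nat.
        norm_inf_1 V L (\<phi>' - (T ^^ k) \<phi>) \<le> q ^ k * norm_inf_1 V L (\<phi>' - \<phi>) \<and>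
        norm_inf_1 V L (\<phi>' - \<phi>) \<le> 1 / p * norm_inf_1 V L (T \<phi> - \<phi>)))"
proof -
  have V: "finite V" by (simp add: V_def)
  note L = \<open>finite L\<close> \<open>L \<noteq> {}\<close>
  have q: "0 \<le> q" "q < 1" and p_eq: "p = 1 - q"
    using \<open>0 < p\<close> \<open>p < 1\<close> by (auto simp: q_def)
  have T_in: "T \<phi> \<in> tuples V L" for \<phi>
    unfolding T_def by (rule T_map_in_tuples)
  have T: "norm_inf_1 V L (T \<phi> - T \<psi>) \<le> q * norm_inf_1 V L (\<phi> - \<psi>)" for \<phi> \<psi>
    unfolding T_def q_def
  proof (rule norm_inf_1_T_map_diff_le[OF V L])
    show "p \<le> 1" using \<open>p < 1\<close> by simp
    show "0 \<le> w i j" if "i \<in> V" "j \<in> nbhd V E i" for i j using assms(14)[OF that] by blast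
    show "(\<Sum>j\<in>nbhd V E i. w i j) = 1" if "i \<in> V" for i by (rule assms(15)[OF that])
  qed
  have bound: "norm_inf_1 V L (\<phi>' - \<phi>) \<le> 1 / p * norm_inf_1 V L (T \<phi> - \<phi>)"
    if "T \<phi>' = \<phi>'" for \<phi>' \<phi>
    using contraction_error_le[of L V T q, OF L T that, of \<phi>] \<open>0 < p\<close>
    by (simp add: p_eq field_simps)
  have pow: "norm_inf_1 V L (\<phi>' - (T ^^ k) \<phi>) \<le> q ^ k * norm_inf_1 V L (\<phi>' - \<phi>)"
    if "T \<phi>' = \<phi>'" for \<phi>' \<phi> k
  proof -
    \<comment> \<open>As \<open>\<phi>'\<close> is fixed by every iterate, the distance to
      \<open>(T ^^ k) \<phi>\<close> is a distance between two \<open>k\<close>-th iterates.\<close>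
    have "(T ^^ k) \<phi>' = \<phi>'" by (induction k) (simp_all add: that)
    then show ?thesis
      using contraction_funpow_le[of V L T q k \<phi>' \<phi>] T q(1) by simp
  qed
  \<comment> \<open>The bound by the residual gives uniqueness: a second fixed point has residual
    zero, hence distance zero from the first.\<close>
  have unique: "\<phi>' = \<phi>"
    if "\<phi>' \<in> tuples V L" "\<phi> \<in> tuples V L" "T \<phi>' = \<phi>'" "T \<phi> = \<phi>" for \<phi>' \<phi>
  proof (rule tuples_eqI[OF V L(1) that(1,2)])
    have "norm_inf_1 V L (T \<phi> - \<phi>) = 0"
      using L by (simp add: that(4) norm_inf_1_def sup_norm_def)
    then show "norm_inf_1 V L (\<phi>' - \<phi>) \<le> 0" using bound[OF that(3), of \<phi>] by simp
  qed
  obtain \<phi>' where "\<phi>' \<in> tuples V L" "T \<phi>' = \<phi>'"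
    using contraction_fixed_point_exists[OF V L T_in T q] by blast
  then have "\<exists>!\<phi>'. \<phi>' \<in> tuples V L \<and> T \<phi>' = \<phi>'"
    by (intro ex1I[of _ \<phi>']) (auto intro: unique)
  then show ?thesis
    by (intro conjI ballI impI allI pow bound)
qed

end
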